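(* Let $(a_n)_{n\in\mathbb{N}}$ be a strictly increasing sequence in $\mathbb{N}$ with $a_n\mid a_{n+1}$ for all $n\in\mathbb{N}$, and let $\mathbf{d}=(d_n)_{n\in\mathbb{N}}$ and the sets $L(A)$ ($A\subseteq\mathbb{N}$) be associated with $(a_n)$ as defined in the context. If $\bar{d}(L(A))>0$ for all infinite $A\subseteq\mathbb{N}$, then $$t_{\mathbf{d}}^s(\mathbb{T})=t_{\mathbf{d}}(\mathbb{T})=\varphi\left(\left\langle\left\{\tfrac{1}{a_n}:n\in\mathbb{N}\right\}\right\rangle\right).$$
   Context: $\mathbb{N}=\{1,2,3,\dots\}$. $\mathbb{T}:=(\mathbb{R},+)/\mathbb{Z}$ is the circle group, $\varphi:\mathbb{R}\to\mathbb{T}$ is the quotient map, $\Vert x\Vert:=\min_{k\in\mathbb{Z}}|x-k|$ for $x\in\mathbb{R}$, and $\langle S\rangle$ is the subgroup of $\mathbb{R}$ generated by $S$. Upper natural density of $A\subseteq\mathbb{N}$: $\bar{d}(A):=\limsup_{n\to\infty}\frac{|A\cap[1,n]|}{n}$. A sequence $(x_n)$ in a metric space $(X,\rho)$ converges statistically to $x_0$ if $\bar{d}(\{n\in\mathbb{N}:\rho(x_n,x_0)\geq\varepsilon\})=0$ for every $\varepsilon>0$. For a strictly increasing sequence $\mathbf{u}=(u_n)$ in $\mathbb{N}$: $t_{\mathbf{u}}(\mathbb{T}):=\{t\in\mathbb{T}:(u_nt)\text{ converges to }0\text{ in }\mathbb{T}\}=\{\varphi(x):x\in\mathbb{R},\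 \Vert u_nx\Vert\to0\}$ and $t^s_{\mathbf{u}}(\mathbb{T}):=\{t\in\mathbb{T}:(u_nt)\text{ converges statistically to }0\text{ in }\mathbb{T}\}$, i.e. the set of $\varphi(x)$, $x\in\mathbb{R}$, with $\bar d(\{n\in\mathbb{N}:\Vert u_nx\Vert\ge\varepsilon\})=0$ for all $\varepsilon>0$. Given $(a_n)$ as in the claim, put $a_0:=1$ and $q_n:=\frac{a_n}{a_{n-1}}$ for $n\in\mathbb{N}$. Then $\mathbf{d}=(d_n)_{n\in\mathbb{N}}$ is the strictly increasing sequence in $\mathbb{N}$ with $\{d_n:n\in\mathbb{N}\}=\{ra_k: r,k\in\mathbb{N},\ 1\leq r<q_{k+1}\}$. The sequence $(a_k)$ is a subsequence of $(d_n)$; write $a_k=d_{n_k}$ for $k\in\mathbb{N}$ (so $n_{k+1}=n_k+q_{k+1}-1$). Put $N_k:=\{n_k,n_k+1,\dots,n_{k+1}-1\}$ and $L(A):=\bigcup_{k\in A}N_k$ for $A\subseteq\mathbb{N}$. *)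

theory Defs
  imports "HOL-Analysis.Analysis" "HOL-Computational_Algebra.Group_Closure"
begin

(* Throughout, the natural numbers of the mathematics start at 1.  A sequence (x_n), n >= 1, is a
   function on nat whose value at 0 is irrelevant. *)

definition int_norm :: "real \<Rightarrow> real"
  where "int_norm x = infdist x \<int>"

lemma int_norm_round: "int_norm x = \<bar>x - of_int (round x)\<bar>"
proof -
  have "int_norm x \<le> dist x (of_int (round x))"
    unfolding int_norm_def by (rule infdist_le) auto
  moreover have "\<bar>x - of_int (round x)\<bar> \<le> int_norm x"
  proof -
    have "(\<int> :: real set) \<noteq> {}"
      by auto
    then have *: "int_norm x = (INF a\<in>\<int>. dist x a)"
      by (simp add: int_norm_def infdist_def)
    show ?thesis
      unfolding * by (rule cINF_greatest) (auto simp: dist_real_def round_diff_minimal elim!: Ints_cases)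
  qed
  ultimately show ?thesis
    by (simp add: dist_real_def)
qed

lemma int_norm_le: "int_norm x \<le> \<bar>x - of_int k\<bar>"
  by (simp add: int_norm_round round_diff_minimal)

lemma int_norm_eq_0_iff: "int_norm x = 0 \<longleftrightarrow> x \<in> \<int>"
proof
  assume "int_norm x = 0"
  then have "x = of_int (round x)"
    by (simp add: int_norm_round)
  then show "x \<in> \<int>"
    by (metis Ints_of_int)
qed (simp add: int_norm_def)

lemma int_norm_add_le: "int_norm (x + y) \<le> int_norm x + int_norm y"
  using int_norm_le[of "x + y" "round x + round y"]
  by (simp add: int_norm_round[of x] int_norm_round[of y])

lemma int_norm_uminus: "int_norm (- x) = int_norm x"
proof -
  have "int_norm (- x) \<le> int_norm x" for x
    using int_norm_le[of "- x" "- round x"] by (simp add: int_norm_round[of x])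
  from this[of x] this[of "- x"] show ?thesis
    by simp
qed

lemma int_norm_cong:
  assumes "x - y \<in> \<int>"
  shows "int_norm x = int_norm y"
proof -
  have "int_norm (x - y) = 0" "int_norm (y - x) = 0"
    using assms int_norm_uminus[of "x - y"] by (auto simp: int_norm_eq_0_iff)
  then show ?thesis
    using int_norm_add_le[of "x - y" y] int_norm_add_le[of "y - x" x] by simp
qed

quotient_type circle = real / "\<lambda>x y :: real. x - y \<in> \<int>"
  morphisms rep_circle circle_of
proof (rule equivpI)
  show "reflp (\<lambda>x y :: real. x - y \<in> \<int>)"
    by (simp add: reflp_def)
  show "symp (\<lambda>x y :: real. x - y \<in> \<int>)"
    by (metis (no_types, lifting) Ints_minus minus_diff_eq sympI)
  show "transp (\<lambda>x y :: real. x - y \<in> \<int>)"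
    by (rule transpI) (metis Ints_add diff_add_cancel add_diff_eq)
qed

instantiation circle :: ab_group_add
begin

lift_definition zero_circle :: circle is 0 .

lift_definition plus_circle :: "circle \<Rightarrow> circle \<Rightarrow> circle" is "(+)"
  by (metis Ints_add add_diff_add)

lift_definition uminus_circle :: "circle \<Rightarrow> circle" is uminus
  by (metis Ints_minus minus_diff_minus)

lift_definition minus_circle :: "circle \<Rightarrow> circle \<Rightarrow> circle" is "(-)"
  by (metis Ints_diff diff_diff_eq2 diff_diff_eq add_diff_eq diff_add_eq add.commute)

instance
  by standard (transfer; simp add: algebra_simps)+

end

instantiation circle :: metric_space
begin

lift_definition dist_circle :: "circle \<Rightarrow> circle \<Rightarrow> real" is "\<lambda>x y. int_norm (x - y)"
proof -
  fix x x' y y' :: real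
  assume "x - x' \<in> \<int>" "y - y' \<in> \<int>"
  then have "(x - x') - (y - y') \<in> \<int>"
    by (rule Ints_diff)
  then show "int_norm (x - y) = int_norm (x' - y')"
    by (intro int_norm_cong) (simp add: algebra_simps)
qed

definition uniformity_circle :: "(circle \<times> circle) filter"
  where "uniformity_circle = (INF e\<in>{0<..}. principal {(x, y). dist x y < e})"

definition open_circle :: "circle set \<Rightarrow> bool"
  where "open_circle U \<longleftrightarrow> (\<forall>x\<in>U. eventually (\<lambda>(x', y). x' = x \<longrightarrow> y \<in> U) uniformity)"

instance
proof
  fix x y z :: circle
  show "dist x y = 0 \<longleftrightarrow> x = y"
    by transfer (rule int_norm_eq_0_iff)
  show "dist x y \<le> dist x z + dist y z"
  proof transfer
    fix x y z :: real
    show "int_norm (x - y) \<le> int_norm (x - z) + int_norm (y - z)"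
      using int_norm_add_le[of "x - z" "z - y"] int_norm_uminus[of "y - z"] by simp
  qed
qed (simp_all only: uniformity_circle_def open_circle_def)

end

definition nat_mult :: "nat \<Rightarrow> 'a::comm_monoid_add \<Rightarrow> 'a"
  where "nat_mult m t = (\<Sum>i<m. t)"

lemma nat_mult_circle_of: "nat_mult m (circle_of x) = circle_of (of_nat m * x)"
  by (induction m)
     (simp_all add: nat_mult_def zero_circle_def plus_circle.abs_eq algebra_simps)

lemma dist_nat_mult_circle_of: "dist (nat_mult m (circle_of x)) 0 = int_norm (of_nat m * x)"
  by (simp add: nat_mult_circle_of zero_circle_def dist_circle.abs_eq)

definition upper_density :: "nat set \<Rightarrow> ereal"
  where "upper_density A = limsup (\<lambda>n. ereal (real (card (A \<inter> {1..n})) / real n))"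

definition stat_conv :: "(nat \<Rightarrow> 'a::metric_space) \<Rightarrow> 'a \<Rightarrow> bool"
  where "stat_conv x l \<longleftrightarrow> (\<forall>\<epsilon>>0. upper_density {n. 1 \<le> n \<and> dist (x n) l \<ge> \<epsilon>} = 0)"

definition char_subgroup :: "(nat \<Rightarrow> nat) \<Rightarrow> circle set"
  where "char_subgroup u = {t. (\<lambda>n. nat_mult (u n) t) \<longlonglongrightarrow> 0}"

definition stat_char_subgroup :: "(nat \<Rightarrow> nat) \<Rightarrow> circle set"
  where "stat_char_subgroup u = {t. stat_conv (\<lambda>n. nat_mult (u n) t) 0}"

(* The update implements the convention a_0 = 1; the division is exact when a_n | a_(n+1). *)
definition ratio :: "(nat \<Rightarrow> nat) \<Rightarrow> nat \<Rightarrow> nat"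
  where "ratio a n = (a(0 := 1)) n div (a(0 := 1)) (n - 1)"

definition d_set :: "(nat \<Rightarrow> nat) \<Rightarrow> nat set"
  where "d_set a = {r * a k | r k. 1 \<le> k \<and> 1 \<le> r \<and> r < ratio a (k + 1)}"

(* enumerate counts from 0, whereas (d_n) is indexed from 1. *)
definition d_seq :: "(nat \<Rightarrow> nat) \<Rightarrow> nat \<Rightarrow> nat"
  where "d_seq a n = enumerate (d_set a) (n - 1)"

definition d_index :: "(nat \<Rightarrow> nat) \<Rightarrow> nat \<Rightarrow> nat"
  where "d_index a k = (THE n. 1 \<le> n \<and> d_seq a n = a k)"

definition d_block :: "(nat \<Rightarrow> nat) \<Rightarrow> nat \<Rightarrow> nat set"
  where "d_block a k = {d_index a k ..< d_index a (k + 1)}"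

definition L_set :: "(nat \<Rightarrow> nat) \<Rightarrow> nat set \<Rightarrow> nat set"
  where "L_set a A = (\<Union>k\<in>A. d_block a k)"

context
  fixes a :: "nat \<Rightarrow> nat"
  assumes pos: "\<And>n. 1 \<le> n \<Longrightarrow> 1 \<le> a n"
    and mono: "strict_mono_on {1..} a"
    and dvd: "\<And>n. 1 \<le> n \<Longrightarrow> a n dvd a (n + 1)"
begin

lemma a_in_d_set:
  assumes "1 \<le> k"
  shows "a k \<in> d_set a"
proof -
  obtain q where q: "a (k + 1) = a k * q"
    using dvd[OF assms] by (elim dvdE)
  have "a k < a (k + 1)"
    using assms by (intro strict_mono_onD[OF mono]) auto
  then have "1 < ratio a (k + 1)"
    using assms pos[OF assms] q by (cases q) (auto simp: ratio_def)
  then show ?thesis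
    using assms unfolding d_set_def by force
qed

lemma infinite_d_set: "infinite (d_set a)"
proof -
  have "inj_on a {1..}"
    using mono by (rule strict_mono_on_imp_inj_on)
  then have "infinite (a ` {1..})"
    by (simp add: finite_image_iff infinite_Ici)
  moreover have "a ` {1..} \<subseteq> d_set a"
    using a_in_d_set by auto
  ultimately show ?thesis
    by (rule infinite_super[rotated])
qed

lemma strict_mono_d_seq: "strict_mono_on {1..} (d_seq a)"
  by (rule strict_mono_onI) (auto simp: d_seq_def infinite_d_set)

lemma range_d_seq: "d_seq a ` {1..} = d_set a"
proof -
  have "d_seq a ` {1..} = enumerate (d_set a) ` ((\<lambda>n. n - 1) ` {1..})"
    by (simp add: d_seq_def image_image)
  also have "(\<lambda>n::nat. n - 1) ` {1..} = UNIV"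
    by (auto simp: image_iff intro!: bexI[of _ "Suc _"])
  finally show ?thesis
    using range_enumerate[OF infinite_d_set] by simp
qed

lemma d_index:
  assumes "1 \<le> k"
  shows "1 \<le> d_index a k \<and> d_seq a (d_index a k) = a k"
  unfolding d_index_def
proof (rule theI')
  obtain n where "1 \<le> n" "d_seq a n = a k"
    using a_in_d_set[OF assms] range_d_seq by force
  moreover have "inj_on (d_seq a) {1..}"
    using strict_mono_d_seq by (rule strict_mono_on_imp_inj_on)
  ultimately show "\<exists>!n. 1 \<le> n \<and> d_seq a n = a k"
    by (metis atLeast_iff inj_onD)
qed

end

end

theory Submission
  imports Defs
begin

text \<open>
  Let \<open>G\<close> be the group generated by the numbers \<open>1 / a n\<close>. A real \<open>x\<close> lies in \<open>G\<close> iff some \<open>a N\<close>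
  makes \<open>a N * x\<close> an integer. As \<open>a N\<close> divides every term of the sequence \<open>d\<close> from \<open>a N\<close> on, the
  multiples \<open>d n * x\<close> of such an \<open>x\<close> are then eventually integers. So \<open>G\<close> maps into the ordinary
  characterized subgroup, which is part of the statistical one, and everything rests on showing that
  a point \<open>x\<close> of the statistical subgroup lies in \<open>G\<close>.

  Suppose that no \<open>a k * x\<close> is an integer, and let \<open>t k > 0\<close> be the distance from \<open>a k * x\<close> to the
  integers and \<open>q k = a (k + 1) / a k \<ge> 2\<close>. As long as \<open>q k * t k < 1 / 2\<close>, passing from \<open>k\<close> to
  \<open>k + 1\<close> multiplies the distance by \<open>q k\<close>, and this cannot go on for ever because distances are
  at most \<open>1 / 2\<close>. Hence the set \<open>A\<close> of all \<open>k\<close> with \<open>q k * t k \<ge> 1 / 2\<close> is infinite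
  (\<open>infinitely_many_wrapping_steps\<close>). The terms of \<open>d\<close> in the block of \<open>k\<close> are the multiples
  \<open>r * a k\<close> with \<open>1 \<le> r < q k\<close>. For \<open>k\<close> in \<open>A\<close> these multiples travel far enough round the circle for
  at least one eighth of the points \<open>r * a k * x\<close> to be at distance at least \<open>1 / 16\<close> from \<open>0\<close>
  (\<open>many_multiples_far_from_Ints\<close>).

  The indices of these far points form a set of upper density \<open>0\<close> by statistical convergence. A set
  which fills a fixed proportion of each block in a union of blocks can have upper density \<open>0\<close> only
  if the whole union does (\<open>upper_density_block_union_eq_0\<close>), so the blocks of \<open>A\<close> have upper density
  \<open>0\<close>. This contradicts the assumption on infinite sets of blocks.
\<close>

section \<open>Multiples of a point of the circle\<close>

lemma int_norm_of_small:
  assumes "\<bar>y\<bar> \<le> 1 / 2"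
  shows "int_norm y = \<bar>y\<bar>"
proof (rule antisym)
  show "int_norm y \<le> \<bar>y\<bar>"
    using int_norm_le[of y 0] by simp
  show "\<bar>y\<bar> \<le> int_norm y"
  proof (cases "round y = 0")
    case False
    then have "\<bar>real_of_int (round y)\<bar> \<ge> 1"
      by linarith
    then show ?thesis
      using assms unfolding int_norm_round by linarith
  qed (simp add: int_norm_round)
qed

lemma int_norm_nonneg: "int_norm x \<ge> 0"
  by (simp add: int_norm_round)

lemma int_norm_le_half: "int_norm x \<le> 1 / 2"
  using of_int_round_abs_le[of x] by (simp add: int_norm_round abs_minus_commute)

lemma int_norm_mult_of_small:
  assumes "real m * int_norm \<theta> \<le> 1 / 2"
  shows "int_norm (real m * \<theta>) = real m * int_norm \<theta>"
proof -
  have abs: "\<bar>real m * (\<theta> - of_int (round \<theta>))\<bar> = real m * int_norm \<theta>"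
    by (simp add: abs_mult int_norm_round)
  have "real m * \<theta> - real m * (\<theta> - of_int (round \<theta>)) = of_int (int m * round \<theta>)"
    by (simp add: algebra_simps)
  then have "real m * \<theta> - real m * (\<theta> - of_int (round \<theta>)) \<in> \<int>"
    by (metis Ints_of_int)
  then have "int_norm (real m * \<theta>) = int_norm (real m * (\<theta> - of_int (round \<theta>)))"
    by (rule int_norm_cong)
  also have "\<dots> = real m * int_norm \<theta>"
    using assms abs by (simp add: int_norm_of_small)
  finally show ?thesis .
qed

text \<open>
  Choose \<open>m\<close>, at most about a quarter of \<open>q\<close>, such that \<open>m * \<theta>\<close> has distance at least \<open>1 / 8\<close> from the
  integers. Two multiples whose indices differ by \<open>m\<close> cannot both be within \<open>1 / 16\<close> of the integers.
  So subtracting \<open>m\<close> injects the near multiples with index above \<open>m\<close> into the far ones, and there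
  are at least half as many far indices as indices above \<open>m\<close>. For small \<open>q\<close>, where rounding would spoil this count,
  the index \<open>m\<close> itself is a far one, and this suffices.
\<close>

lemma many_multiples_far_from_Ints:
  fixes q :: nat
  assumes q: "q \<ge> 2" and large: "real q * int_norm \<theta> \<ge> 1 / 2"
  shows "q - 1 \<le> 8 * card {r \<in> {1..<q}. int_norm (real r * \<theta>) \<ge> 1 / 16}"
proof -
  define t where "t = int_norm \<theta>"
  \<comment> \<open>The first multiple of \<open>t\<close> to reach \<open>1 / 8\<close> is \<open>m * t\<close>. It does not overshoot \<open>1 / 2\<close>, so it
    is the distance from \<open>m * \<theta>\<close> to the integers.\<close>
  define m where "m = nat \<lceil>1 / (8 * t)\<rceil>"
  define far where "far = {r \<in> {1..<q}. int_norm (real r * \<theta>) \<ge> 1 / 16}"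
  define near where "near = {r \<in> {m<..<q}. int_norm (real r * \<theta>) < 1 / 16}"
  have t: "t > 0" "t \<le> 1 / 2" "real q * t \<ge> 1 / 2"
    using large int_norm_nonneg[of \<theta>] int_norm_le_half[of \<theta>]
    by (auto simp: t_def less_le)
  have m_ge: "real m \<ge> 1 / (8 * t)"
    unfolding m_def by (rule real_nat_ceiling_ge)
  have m_less: "real m < 1 / (8 * t) + 1"
    using t by (simp add: m_def) linarith
  have m_pos: "m \<ge> 1"
    using m_ge t by (cases m) (auto simp: field_simps)
  have mt_ge: "real m * t \<ge> 1 / 8"
    using m_ge t by (simp add: field_simps)
  have mt_le: "real m * t \<le> 1 / 2"
  proof (cases "t < 1 / 8")
    case True
    have "real m * t < 1 / 8 + t"
      using m_less t by (simp add: field_simps)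
    then show ?thesis
      using True by simp
  next
    case False
    then have "1 / (8 * t) \<le> 1"
      using t by (simp add: field_simps)
    then have "m = 1"
      using m_less m_pos by linarith
    then show ?thesis
      using t by simp
  qed
  have m_far: "int_norm (real m * \<theta>) \<ge> 1 / 8"
    using int_norm_mult_of_small[of m \<theta>] mt_ge mt_le by (simp add: t_def)
  have "1 / (8 * t) \<le> real q / 4"
    using t by (simp add: field_simps)
  then have m_q: "4 * m < q + 4"
    using m_less by linarith
  have fin: "finite far" "finite near"
    by (auto simp: far_def near_def)

  have "(\<lambda>r. r - m) ` near \<subseteq> far"
  proof (rule image_subsetI)
    fix r assume r: "r \<in> near"
    then have "real m * \<theta> = real r * \<theta> + - (real (r - m) * \<theta>)"
      by (auto simp: near_def algebra_simps of_nat_diff)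
    then have "1 / 8 \<le> int_norm (real r * \<theta>) + int_norm (real (r - m) * \<theta>)"
      using m_far int_norm_add_le[of "real r * \<theta>" "- (real (r - m) * \<theta>)"]
      by (simp add: int_norm_uminus)
    then show "r - m \<in> far"
      using r by (auto simp: near_def far_def)
  qed
  moreover have "inj_on (\<lambda>r. r - m) near"
    by (auto simp: inj_on_def near_def)
  ultimately have "card near \<le> card far"
    using fin card_inj_on_le by blast
  moreover have "q - 1 - m \<le> card near + card far"
  proof -
    have "{m<..<q} \<subseteq> near \<union> far"
      by (auto simp: near_def far_def)
    then have "card {m<..<q} \<le> card (near \<union> far)"
      using fin by (intro card_mono) auto
    also have "\<dots> \<le> card near + card far"
      by (rule card_Un_le)
    finally show ?thesis
      by simp
  qed
  ultimately have many: "q - 1 - m \<le> 2 * card far"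
    by simp
  have "m < q"
    using m_q m_pos q by (cases "q = 2") auto
  then have "m \<in> far"
    using m_far m_pos by (auto simp: far_def)
  then have "card far \<ge> 1"
    using fin by (metis One_nat_def Suc_leI card_gt_0_iff empty_iff)
  \<comment> \<open>For \<open>q \<le> 9\<close> the single far index \<open>m\<close> is enough, and for larger \<open>q\<close> the pairing is.\<close>
  then have "q - 1 \<le> 8 * card far"
    using many m_q by linarith
  then show ?thesis
    by (simp add: far_def)
qed

text \<open>
  If \<open>q k\<close> times the distance from \<open>a k * x\<close> to the integers is below \<open>1 / 2\<close>, then it is the distance
  from \<open>a (k + 1) * x\<close>, which has therefore at least doubled. Distances are bounded, so they
  cannot double at every step from some point on.
\<close>

lemma infinitely_many_wrapping_steps:
  fixes a q :: "nat \<Rightarrow> nat" and x :: real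
  assumes step: "\<And>k. 1 \<le> k \<Longrightarrow> a (k + 1) = q k * a k"
    and q: "\<And>k. 1 \<le> k \<Longrightarrow> q k \<ge> 2"
    and nonint: "\<And>k. 1 \<le> k \<Longrightarrow> real (a k) * x \<notin> \<int>"
  shows "infinite {k. 1 \<le> k \<and> real (q k) * int_norm (real (a k) * x) \<ge> 1 / 2}"
proof
  assume "finite {k. 1 \<le> k \<and> real (q k) * int_norm (real (a k) * x) \<ge> 1 / 2}"
  then obtain K0 where K0: "\<forall>k\<in>{k. 1 \<le> k \<and> real (q k) * int_norm (real (a k) * x) \<ge> 1 / 2}. k \<le> K0"
    by (auto simp: finite_nat_set_iff_bounded_le)
  have small: "real (q k) * int_norm (real (a k) * x) < 1 / 2" if "k \<ge> K0 + 1" for k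
  proof (rule ccontr)
    assume "\<not> ?thesis"
    then have "k \<le> K0"
      using K0 that by (intro bspec[OF K0]) simp
    then show False
      using that by simp
  qed
  define K where "K = K0 + 1"
  have growth: "2 ^ j * int_norm (real (a K) * x) \<le> int_norm (real (a (K + j)) * x)" for j
  proof (induction j)
    case (Suc j)
    have k: "1 \<le> K + j" "K + j \<ge> K0 + 1"
      by (auto simp: K_def)
    have "2 ^ Suc j * int_norm (real (a K) * x) \<le> 2 * int_norm (real (a (K + j)) * x)"
      using Suc by simp
    also have "\<dots> \<le> real (q (K + j)) * int_norm (real (a (K + j)) * x)"
      using q[OF k(1)] by (intro mult_right_mono int_norm_nonneg) simp
    also have "\<dots> = int_norm (real (q (K + j)) * (real (a (K + j)) * x))"
      using small[OF k(2)] by (intro int_norm_mult_of_small[symmetric]) simp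
    also have "\<dots> = int_norm (real (a (K + Suc j)) * x)"
      using step[OF k(1)] by (simp add: mult.assoc)
    finally show ?case .
  qed simp
  have pos: "int_norm (real (a K) * x) > 0"
    using nonint[of K] int_norm_nonneg[of "real (a K) * x"] int_norm_eq_0_iff[of "real (a K) * x"]
    by (auto simp: K_def less_le)
  obtain j where "1 / int_norm (real (a K) * x) < 2 ^ j"
    using real_arch_pow[of 2] by auto
  then have "1 < 2 ^ j * int_norm (real (a K) * x)"
    using pos by (simp add: field_simps)
  then show False
    using growth[of j] int_norm_le_half[of "real (a (K + j)) * x"] by linarith
qed


section \<open>Upper density\<close>

lemma upper_density_nonneg: "upper_density A \<ge> 0"
  unfolding upper_density_def
  by (intro le_Limsup) (auto intro!: always_eventually)

lemma upper_density_leI: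
  assumes "eventually (\<lambda>n. real (card (A \<inter> {1..n})) \<le> c * real n) sequentially"
  shows "upper_density A \<le> ereal c"
  unfolding upper_density_def
proof (rule Limsup_bounded)
  show "eventually (\<lambda>n. ereal (real (card (A \<inter> {1..n})) / real n) \<le> ereal c) sequentially"
    using assms eventually_gt_at_top[of 0] by eventually_elim (simp add: field_simps)
qed

lemma upper_density_finite:
  assumes "finite A"
  shows "upper_density A = 0"
proof (rule antisym[OF _ upper_density_nonneg])
  show "upper_density A \<le> 0"
  proof (rule ereal_le_epsilon2)
    fix e :: real assume e: "e > 0"
    have "upper_density A \<le> ereal e"
    proof (rule upper_density_leI)
      show "eventually (\<lambda>n. real (card (A \<inter> {1..n})) \<le> e * real n) sequentially"
        using eventually_ge_at_top[of "nat \<lceil>real (card A) / e\<rceil>"]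
      proof eventually_elim
        case (elim n)
        have "real (card (A \<inter> {1..n})) \<le> real (card A)"
          using assms by (auto intro: card_mono)
        moreover have "real (card A) / e \<le> real n"
          using elim by linarith
        ultimately show ?case
          using e by (simp add: field_simps)
      qed
    qed
    then show "upper_density A \<le> 0 + ereal e"
      by simp
  qed
qed

lemma eventually_card_le_of_upper_density_0:
  assumes "upper_density B = 0" "e > 0"
  shows "eventually (\<lambda>n. real (card (B \<inter> {1..n})) \<le> e * real n) sequentially"
proof -
  have "limsup (\<lambda>n. ereal (real (card (B \<inter> {1..n})) / real n)) < ereal e"
    using assms by (simp add: upper_density_def)
  then have "eventually (\<lambda>n. ereal (real (card (B \<inter> {1..n})) / real n) < ereal e) sequentially"
    by (rule Limsup_lessD)
  then show ?thesis
    using eventually_gt_at_top[of 0] by eventually_elim (simp add: field_simps)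
qed

text \<open>
  Suppose that \<open>B\<close> contains a fixed proportion of each block \<open>{s k..<s (k + 1)}\<close> with \<open>k\<close> in \<open>A\<close>. Adding
  up blocks, \<open>B\<close> then contains at least that proportion of the union below any block boundary. An
  initial segment that stops inside a block is the delicate case: \<open>B\<close> may sit entirely at the end of
  the block. One then extends the segment to the end of the block. All the points
  gained belong to the union, so its share in the longer segment is at least as large, and the bound
  at the boundary applies.
\<close>

lemma upper_density_block_union_eq_0:
  fixes s :: "nat \<Rightarrow> nat" and C :: nat
  assumes s: "strict_mono_on {1..} s" and s1: "1 \<le> s 1"
    and A: "A \<subseteq> {1..}"
    and dens: "\<And>k. k \<in> A \<Longrightarrow> card {s k..<s (k + 1)} \<le> C * card (B \<inter> {s k..<s (k + 1)})"
    and B: "upper_density B = 0"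
  shows "upper_density (\<Union>k\<in>A. {s k..<s (k + 1)}) = 0"
proof -
  define L where "L = (\<Union>k\<in>A. {s k..<s (k + 1)})"
  have s_mono: "s i \<le> s j" if "1 \<le> i" "i \<le> j" for i j
    using that strict_mono_onD[OF s, of i j] by (cases "i = j") auto
  have s_ge: "k \<le> s k" if "1 \<le> k" for k
    using that
  proof (induction k rule: nat_induct_at_least)
    case (Suc k)
    then show ?case
      using strict_mono_onD[OF s, of k "Suc k"] by auto
  qed (rule s1)
  \<comment> \<open>Two distinct blocks are disjoint, so a block outside the union contributes nothing.\<close>
  have block: "L \<inter> {s k..<s (k + 1)} = (if k \<in> A then {s k..<s (k + 1)} else {})" if k: "1 \<le> k" for k
  proof -
    have "j = k" if "j \<in> A" "n \<in> {s j..<s (j + 1)}" "n \<in> {s k..<s (k + 1)}" for j n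
    proof (rule ccontr)
      assume "j \<noteq> k"
      then consider "j + 1 \<le> k" | "k + 1 \<le> j"
        by linarith
      then show False
        using that k s_mono[of "j + 1" k] s_mono[of "k + 1" j] by cases auto
    qed
    then have "j \<in> A \<Longrightarrow> n \<in> {s j..<s (j + 1)} \<Longrightarrow> n \<in> {s k..<s (k + 1)} \<Longrightarrow> k \<in> A" for j n
      by metis
    then show ?thesis
      unfolding L_def by (cases "k \<in> A") (simp_all only: if_True if_False, blast+)
  qed
  have below: "L \<inter> {1..<s 1} = {}"
  proof -
    have "s 1 \<le> s k" if "k \<in> A" for k
      using that A s_mono[of 1 k] by auto
    then show ?thesis
      by (fastforce simp: L_def)
  qed
  have split: "card (X \<inter> {1..<s (k + 1)}) = card (X \<inter> {1..<s k}) + card (X \<inter> {s k..<s (k + 1)})"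
    if "1 \<le> k" for k and X :: "nat set"
  proof -
    have "X \<inter> {1..<s (k + 1)} = X \<inter> {1..<s k} \<union> X \<inter> {s k..<s (k + 1)}"
      using that s_mono[of k "k + 1"] s_ge[of k] by auto
    then show ?thesis
      by (simp only:) (rule card_Un_disjoint; auto)
  qed
  have full: "card (L \<inter> {1..<s K}) \<le> C * card (B \<inter> {1..<s K})" if "1 \<le> K" for K
    using that
  proof (induction K rule: nat_induct_at_least)
    case base
    then show ?case
      using below by simp
  next
    case (Suc k)
    have "card (L \<inter> {s k..<s (k + 1)}) \<le> C * card (B \<inter> {s k..<s (k + 1)})"
      using block[OF Suc.hyps] dens[of k] by auto
    then show ?case
      using Suc.IH split[OF Suc.hyps, of L] split[OF Suc.hyps, of B] by (simp add: algebra_simps)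
  qed

  have "upper_density L \<le> ereal e" if e: "e > 0" for e
  proof (rule upper_density_leI)
    \<comment> \<open>\<open>B\<close> is eventually so sparse that \<open>C\<close> times its share is below \<open>e\<close>, and also below \<open>1\<close>: the
      points gained by extending a segment then outnumber the increase of the bound.\<close>
    define \<eta> where "\<eta> = min 1 e / (real C + 1)"
    have "\<eta> > 0"
      using e by (simp add: \<eta>_def add_nonneg_pos)
    moreover have "real C * \<eta> \<le> min 1 e"
    proof -
      have "(real C + 1) * \<eta> = min 1 e"
        by (simp add: \<eta>_def)
      then show ?thesis
        using \<open>\<eta> > 0\<close> by (simp only: distrib_right)
    qed
    ultimately have \<eta>: "\<eta> > 0" "real C * \<eta> \<le> 1" "real C * \<eta> \<le> e"
      by auto
    obtain N where N: "\<And>n. n \<ge> N \<Longrightarrow> real (card (B \<inter> {1..n})) \<le> \<eta> * real n"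
      using eventually_card_le_of_upper_density_0[OF B \<eta>(1)] by (auto simp: eventually_sequentially)
    have "real (card (L \<inter> {1..n})) \<le> e * real n" if n: "n \<ge> N" for n
    proof (cases "n < s 1")
      case True
      then have "L \<inter> {1..n} \<subseteq> {}"
        using below by auto
      then show ?thesis
        using e by simp
    next
      case False
      \<comment> \<open>The block containing \<open>n\<close>.\<close>
      define k where "k = (LEAST k. n < s (k + 1))"
      have n_less: "n < s (k + 1)"
        unfolding k_def by (rule LeastI[of _ n]) (use s_ge[of "n + 1"] in auto)
      have k: "1 \<le> k"
        using n_less False by (cases k) auto
      have n_ge: "s k \<le> n"
        using not_less_Least[of "k - 1" "\<lambda>k. n < s (k + 1)"] k by (simp add: k_def)
      have "real (card (L \<inter> {1..n})) \<le> real C * \<eta> * real n"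
      proof (cases "k \<in> A")
        case True
        \<comment> \<open>Extend the segment to the end \<open>M\<close> of the block.\<close>
        define M where "M = s (k + 1) - 1"
        have M: "n \<le> M" "{1..<s (k + 1)} = {1..M}"
          using n_less by (auto simp: M_def)
        have "{s k..<s (k + 1)} \<subseteq> L"
          using True by (auto simp: L_def)
        then have "{n<..M} \<subseteq> L"
          using n_ge n_less by (auto simp: M_def subset_iff)
        then have "L \<inter> {1..M} = L \<inter> {1..n} \<union> {n<..M}"
          using M by auto
        then have "card (L \<inter> {1..M}) = card (L \<inter> {1..n}) + (M - n)"
          by (simp only:) (subst card_Un_disjoint; auto)
        then have "real (card (L \<inter> {1..n})) + (real M - real n) = real (card (L \<inter> {1..M}))"
          using M(1) by (simp add: of_nat_diff)
        also have "\<dots> \<le> real C * real (card (B \<inter> {1..M}))"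
          using full[of "k + 1"] M(2) by (simp flip: of_nat_mult)
        also have "\<dots> \<le> real C * (\<eta> * real M)"
          using N[of M] n M(1) by (intro mult_left_mono) auto
        also have "\<dots> = real C * \<eta> * real n + real C * \<eta> * (real M - real n)"
          by (simp add: algebra_simps)
        also have "\<dots> \<le> real C * \<eta> * real n + 1 * (real M - real n)"
          using \<eta>(2) M(1) by (intro add_left_mono mult_right_mono) auto
        finally show ?thesis
          by simp
      next
        case False
        have "L \<inter> {1..n} \<subseteq> L \<inter> {1..<s k}"
          using block[OF k] False n_less by auto
        then have "card (L \<inter> {1..n}) \<le> card (L \<inter> {1..<s k})"
          by (intro card_mono) auto
        also have "\<dots> \<le> C * card (B \<inter> {1..<s k})"
          by (rule full[OF k])
        also have "\<dots> \<le> C * card (B \<inter> {1..n})"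
          using n_ge by (intro mult_left_mono card_mono) auto
        finally have "real (card (L \<inter> {1..n})) \<le> real C * real (card (B \<inter> {1..n}))"
          by (simp flip: of_nat_mult)
        also have "\<dots> \<le> real C * (\<eta> * real n)"
          using N[OF n] by (intro mult_left_mono) auto
        finally show ?thesis
          by (simp add: mult.assoc)
      qed
      also have "\<dots> \<le> e * real n"
        using \<eta>(3) by (intro mult_right_mono) auto
      finally show ?thesis .
    qed
    then show "eventually (\<lambda>n. real (card (L \<inter> {1..n})) \<le> e * real n) sequentially"
      by (auto simp: eventually_sequentially)
  qed
  then have "upper_density L \<le> 0"
    using ereal_le_epsilon2[of "upper_density L" 0] by simp
  then show ?thesis
    using upper_density_nonneg[of L] by (simp add: L_def)
qed


section \<open>The blocks of the sequence\<close>

context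
  fixes a :: "nat \<Rightarrow> nat"
  assumes pos: "\<And>n. 1 \<le> n \<Longrightarrow> 1 \<le> a n"
    and mono: "strict_mono_on {1..} a"
    and dvd: "\<And>n. 1 \<le> n \<Longrightarrow> a n dvd a (n + 1)"
begin

lemma a_le:
  assumes "1 \<le> i" "i \<le> j"
  shows "a i \<le> a j"
  using assms strict_mono_onD[OF mono, of i j] by (cases "i = j") auto

lemma a_dvd:
  assumes "1 \<le> i" "i \<le> j"
  shows "a i dvd a j"
  using assms(2)
proof (induction j rule: dec_induct)
  case (step n)
  then show ?case
    using dvd[of n] assms(1) by (auto intro: dvd_trans)
qed simp

lemma a_Suc_eq:
  assumes "1 \<le> k"
  shows "a (k + 1) = ratio a (k + 1) * a k"
  using assms dvd[OF assms] by (simp add: ratio_def)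

lemma ratio_ge_2:
  assumes "1 \<le> k"
  shows "ratio a (k + 1) \<ge> 2"
proof -
  have "a k < a (k + 1)"
    using assms by (intro strict_mono_onD[OF mono]) auto
  then have "\<not> ratio a (k + 1) \<le> 1"
    using a_Suc_eq[OF assms] mult_right_mono[of "ratio a (k + 1)" 1 "a k"] by auto
  then show ?thesis
    by simp
qed

text \<open>
  A multiple \<open>r * a j\<close> with \<open>1 \<le> r < q\<close>, \<open>q\<close> being the next ratio, lies in the interval from \<open>a j\<close> up to
  \<open>a (j + 1)\<close>, and these intervals are disjoint for different \<open>j\<close>.
\<close>

lemma d_set_between:
  assumes k: "1 \<le> k"
  shows "{d \<in> d_set a. a k \<le> d \<and> d < a (k + 1)} = (\<lambda>r. r * a k) ` {1..<ratio a (k + 1)}"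
proof (intro equalityI subsetI)
  fix d assume d: "d \<in> {d \<in> d_set a. a k \<le> d \<and> d < a (k + 1)}"
  then obtain r j where j: "d = r * a j" "1 \<le> j" "1 \<le> r" "r < ratio a (j + 1)"
    by (auto simp: d_set_def)
  have "r * a j < ratio a (j + 1) * a j"
    using j pos[OF j(2)] by (intro mult_strict_right_mono) auto
  then have "d < a (j + 1)"
    using j a_Suc_eq[OF j(2)] by simp
  moreover have "a j \<le> d"
    using j by simp
  ultimately have "\<not> j + 1 \<le> k" "\<not> k + 1 \<le> j"
    using d a_le[of "j + 1" k] a_le[of "k + 1" j] by auto
  then have "j = k"
    by simp
  then show "d \<in> (\<lambda>r. r * a k) ` {1..<ratio a (k + 1)}"
    using j by auto
next
  fix d assume "d \<in> (\<lambda>r. r * a k) ` {1..<ratio a (k + 1)}"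
  then obtain r where r: "d = r * a k" "1 \<le> r" "r < ratio a (k + 1)"
    by (force simp del: mult_cancel2)
  have "r * a k < ratio a (k + 1) * a k"
    using r pos[OF k] by (intro mult_strict_right_mono) auto
  then show "d \<in> {d \<in> d_set a. a k \<le> d \<and> d < a (k + 1)}"
    using r k a_Suc_eq[OF k] by (auto simp: d_set_def)
qed

lemma d_seq_less_iff:
  assumes "1 \<le> m" "1 \<le> n"
  shows "d_seq a m < d_seq a n \<longleftrightarrow> m < n"
  using strict_mono_on_less[OF strict_mono_d_seq[OF pos mono dvd], of m n] assms by auto

lemma strict_mono_d_index: "strict_mono_on {1..} (d_index a)"
proof (rule strict_mono_onI)
  fix i j :: nat assume ij: "i \<in> {1..}" "j \<in> {1..}" "i < j"
  then have "a i < a j"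
    using strict_mono_onD[OF mono] by blast
  then show "d_index a i < d_index a j"
    using ij d_index[OF pos mono dvd, of i] d_index[OF pos mono dvd, of j]
      d_seq_less_iff[of "d_index a i" "d_index a j"] by auto
qed

text \<open>
  Membership in a block is expressed through the values of the sequence, so that the blocks can be
  matched with the multiples found in \<open>d_set_between\<close> without computing any index.
\<close>

lemma d_block_eq:
  assumes "1 \<le> k"
  shows "d_block a k = {n. 1 \<le> n \<and> a k \<le> d_seq a n \<and> d_seq a n < a (k + 1)}"
proof -
  have i: "1 \<le> d_index a k" "d_seq a (d_index a k) = a k"
    and j: "1 \<le> d_index a (k + 1)" "d_seq a (d_index a (k + 1)) = a (k + 1)"
    using assms d_index[OF pos mono dvd, of k] d_index[OF pos mono dvd, of "k + 1"] by auto
  have "n \<in> d_block a k \<longleftrightarrow> 1 \<le> n \<and> a k \<le> d_seq a n \<and> d_seq a n < a (k + 1)" for n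
  proof (cases "1 \<le> n")
    case True
    then show ?thesis
      using d_seq_less_iff[OF True i(1)] d_seq_less_iff[OF True j(1)] i j
      by (auto simp: d_block_def not_less)
  next
    case False
    then show ?thesis
      using i(1) by (auto simp: d_block_def)
  qed
  then show ?thesis
    by auto
qed

text \<open>
  Counting indices in a block amounts to counting multipliers, since the sequence is injective and
  so is multiplication by \<open>a k\<close>.
\<close>

lemma card_d_block_filter:
  assumes k: "1 \<le> k"
  shows "card {n \<in> d_block a k. P (d_seq a n)} = card {r \<in> {1..<ratio a (k + 1)}. P (r * a k)}"
proof -
  have inj: "inj_on (d_seq a) {1..}"
    using strict_mono_d_seq[OF pos mono dvd] by (rule strict_mono_on_imp_inj_on)
  have range: "d_seq a ` {1..} = d_set a"
    by (rule range_d_seq[OF pos mono dvd])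
  have mem: "d \<in> d_set a \<longleftrightarrow> (\<exists>n\<ge>1. d = d_seq a n)" for d
    unfolding range[symmetric] by auto
  have "d_seq a ` {n \<in> d_block a k. P (d_seq a n)} = {d \<in> d_set a. a k \<le> d \<and> d < a (k + 1) \<and> P d}"
    using mem d_block_eq[OF k] by auto
  also have "\<dots> = {d \<in> {d \<in> d_set a. a k \<le> d \<and> d < a (k + 1)}. P d}"
    by auto
  also have "\<dots> = (\<lambda>r. r * a k) ` {r \<in> {1..<ratio a (k + 1)}. P (r * a k)}"
    unfolding d_set_between[OF k] by auto
  finally have "card (d_seq a ` {n \<in> d_block a k. P (d_seq a n)})
      = card ((\<lambda>r. r * a k) ` {r \<in> {1..<ratio a (k + 1)}. P (r * a k)})"
    by simp
  moreover have "inj_on (d_seq a) {n \<in> d_block a k. P (d_seq a n)}"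
    using inj by (rule inj_on_subset) (auto simp: d_block_eq[OF k])
  moreover have "inj_on (\<lambda>r. r * a k) {r \<in> {1..<ratio a (k + 1)}. P (r * a k)}"
    using pos[OF k] by (auto simp: inj_on_def)
  ultimately show ?thesis
    by (simp add: card_image)
qed


section \<open>The two subgroups\<close>

text \<open>
  The generated group is the set of all fractions with some \<open>a N\<close> as denominator: by divisibility, two
  such fractions have the larger of the two denominators in common.
\<close>

lemma group_closure_inverse_a:
  "x \<in> group_closure {1 / real (a n) | n. 1 \<le> n} \<longleftrightarrow> (\<exists>N\<ge>1. real (a N) * x \<in> \<int>)"
proof
  assume "x \<in> group_closure {1 / real (a n) | n. 1 \<le> n}"
  then show "\<exists>N\<ge>1. real (a N) * x \<in> \<int>"
  proof (induction rule: group_closure.induct)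
    case (base s)
    then show ?case
      using pos by (force simp: image_iff)
  next
    case (diff x y)
    then obtain M N where MN: "1 \<le> M" "real (a M) * x \<in> \<int>" "1 \<le> N" "real (a N) * y \<in> \<int>"
      by blast
    have mult: "real (a m) * z \<in> \<int>" if n: "real (a n) * z \<in> \<int>" "1 \<le> n" "n \<le> m" for m n z
    proof -
      obtain c where "a m = a n * c"
        using a_dvd[OF n(2,3)] by blast
      then have eq: "real (a m) * z = real c * (real (a n) * z)"
        by simp
      show ?thesis
        unfolding eq by (rule Ints_mult[OF Ints_of_nat n(1)])
    qed
    have "real (a (max M N)) * x - real (a (max M N)) * y \<in> \<int>"
      using mult[OF MN(2,1)] mult[OF MN(4,3)] by (intro Ints_diff) simp_all
    then show ?case
      using MN by (intro exI[of _ "max M N"]) (auto simp: algebra_simps)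
  qed
next
  assume "\<exists>N\<ge>1. real (a N) * x \<in> \<int>"
  then obtain N z where N: "1 \<le> N" "real (a N) * x = of_int z"
    by (auto elim!: Ints_cases)
  have gen: "1 / real (a N) \<in> group_closure {1 / real (a n) | n. 1 \<le> n}"
    using N(1) by (intro group_closure.base) auto
  have nat: "real m * (1 / real (a N)) \<in> group_closure {1 / real (a n) | n. 1 \<le> n}" for m
    using gen by (rule group_closure_scalar_mult_left)
  have "x = of_int z * (1 / real (a N))"
    using N pos[OF N(1)] by (simp add: field_simps)
  then show "x \<in> group_closure {1 / real (a n) | n. 1 \<le> n}"
  proof (cases z rule: int_cases2)
    case (nonneg m)
    then show ?thesis
      using \<open>x = _\<close> nat[of m] by simp
  next
    case (nonpos m)
    then show ?thesis
      using \<open>x = _\<close> nat[of m] by simp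
  qed
qed

text \<open>
  From \<open>a N\<close> on, every term of the sequence is a multiple of some \<open>a k\<close> with \<open>k \<ge> N\<close>, hence of \<open>a N\<close>.
\<close>

lemma d_seq_mult_eventually_Ints:
  assumes N: "1 \<le> N" and x: "real (a N) * x \<in> \<int>" and n: "d_index a N \<le> n"
  shows "real (d_seq a n) * x \<in> \<int>"
proof -
  have i: "1 \<le> d_index a N" "d_seq a (d_index a N) = a N"
    using d_index[OF pos mono dvd N] by auto
  then have "1 \<le> n"
    using n by simp
  then have "a N \<le> d_seq a n"
    using d_seq_less_iff[of n "d_index a N"] i n by auto
  moreover have "d_seq a n \<in> d_set a"
    using range_d_seq[OF pos mono dvd] \<open>1 \<le> n\<close> by auto
  then obtain r k where k: "d_seq a n = r * a k" "1 \<le> k" "r < ratio a (k + 1)"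
    by (auto simp: d_set_def)
  have "r * a k < ratio a (k + 1) * a k"
    using k pos[OF k(2)] by (intro mult_strict_right_mono) auto
  then have "d_seq a n < a (k + 1)"
    using k a_Suc_eq[OF k(2)] by simp
  ultimately have "N \<le> k"
    using a_le[of "k + 1" N] by (cases "N \<le> k") auto
  then obtain c where "a k = a N * c"
    using a_dvd[OF N] by blast
  then have eq: "real (d_seq a n) * x = real (r * c) * (real (a N) * x)"
    using k by simp
  show ?thesis
    unfolding eq by (rule Ints_mult[OF Ints_of_nat x])
qed

text \<open>
  Otherwise the blocks in which the multiples of \<open>x\<close> travel at least
  half way round the circle are infinite in number, and each has at least an eighth of its indices
  in the set \<open>B\<close> of exceptions to statistical convergence; but \<open>B\<close> is too sparse for that.
\<close>

lemma ex_mult_Ints_of_stat_char: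
  assumes thick: "\<And>A. A \<subseteq> {1..} \<Longrightarrow> infinite A \<Longrightarrow> upper_density (L_set a A) > 0"
    and stat: "circle_of x \<in> stat_char_subgroup (d_seq a)"
  shows "\<exists>N\<ge>1. real (a N) * x \<in> \<int>"
proof (rule ccontr)
  assume nonint: "\<not> (\<exists>N\<ge>1. real (a N) * x \<in> \<int>)"
  define A where "A = {k. 1 \<le> k \<and> real (ratio a (k + 1)) * int_norm (real (a k) * x) \<ge> 1 / 2}"
  define B where "B = {n. 1 \<le> n \<and> int_norm (real (d_seq a n) * x) \<ge> 1 / 16}"
  have A: "infinite A" "A \<subseteq> {1..}"
    using infinitely_many_wrapping_steps[of a "\<lambda>k. ratio a (k + 1)" x] a_Suc_eq ratio_ge_2 nonint
    by (auto simp: A_def)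
  have B: "upper_density B = 0"
  proof -
    have "\<forall>e>0. upper_density {n. 1 \<le> n \<and> int_norm (real (d_seq a n) * x) \<ge> e} = 0"
      using stat by (simp add: stat_char_subgroup_def stat_conv_def dist_nat_mult_circle_of)
    then show ?thesis
      unfolding B_def by (rule allE[of _ "1 / 16"]) (erule mp, simp)
  qed
  have "upper_density (\<Union>k\<in>A. {d_index a k..<d_index a (k + 1)}) = 0"
  proof (rule upper_density_block_union_eq_0[where C = 8, OF strict_mono_d_index _ A(2) _ B])
    show "1 \<le> d_index a 1"
      using d_index[OF pos mono dvd, of 1] by simp
    fix k assume kA: "k \<in> A"
    then have k: "1 \<le> k"
      by (simp add: A_def)
    have "{n \<in> d_block a k. True} = d_block a k" "{r \<in> {1..<q}. True} = {1..<q}" for q :: nat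
      by auto
    then have "card (d_block a k) = ratio a (k + 1) - 1"
      using card_d_block_filter[OF k, of "\<lambda>_. True"] by (simp only: card_atLeastLessThan)
    also have "\<dots> \<le> 8 * card {r \<in> {1..<ratio a (k + 1)}. int_norm (real r * (real (a k) * x)) \<ge> 1 / 16}"
      using kA by (intro many_multiples_far_from_Ints ratio_ge_2[OF k]) (simp add: A_def)
    also have "\<dots> = 8 * card {n \<in> d_block a k. int_norm (real (d_seq a n) * x) \<ge> 1 / 16}"
      using card_d_block_filter[OF k, of "\<lambda>d. int_norm (real d * x) \<ge> 1 / 16"] by (simp add: mult.assoc)
    also have "{n \<in> d_block a k. int_norm (real (d_seq a n) * x) \<ge> 1 / 16} = B \<inter> d_block a k"
      by (auto simp: B_def d_block_eq[OF k])
    finally show "card {d_index a k..<d_index a (k + 1)} \<le> 8 * card (B \<inter> {d_index a k..<d_index a (k + 1)})"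
      by (simp add: d_block_def)
  qed
  then show False
    using thick[OF A(2,1)] by (simp add: L_set_def d_block_def)
qed

end

lemma char_subgroup_subset_stat_char_subgroup: "char_subgroup u \<subseteq> stat_char_subgroup u"
proof
  fix t assume "t \<in> char_subgroup u"
  then have lim: "(\<lambda>n. nat_mult (u n) t) \<longlonglongrightarrow> 0"
    by (simp add: char_subgroup_def)
  have "upper_density {n. 1 \<le> n \<and> dist (nat_mult (u n) t) 0 \<ge> e} = 0" if "e > 0" for e
  proof (rule upper_density_finite)
    obtain N where "\<And>n. n \<ge> N \<Longrightarrow> dist (nat_mult (u n) t) 0 < e"
      using tendstoD[OF lim \<open>e > 0\<close>] by (auto simp: eventually_sequentially)
    then have "{n. 1 \<le> n \<and> dist (nat_mult (u n) t) 0 \<ge> e} \<subseteq> {..<N}"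
      by (force simp: not_less[symmetric])
    then show "finite {n. 1 \<le> n \<and> dist (nat_mult (u n) t) 0 \<ge> e}"
      by (rule finite_subset) simp
  qed
  then show "t \<in> stat_char_subgroup u"
    by (simp add: stat_char_subgroup_def stat_conv_def)
qed

theorem theorem3p5:
  fixes a :: "nat \<Rightarrow> nat"
  assumes "\<And>n. 1 \<le> n \<Longrightarrow> 1 \<le> a n"
    and "strict_mono_on {1..} a"
    and "\<And>n. 1 \<le> n \<Longrightarrow> a n dvd a (n + 1)"
    and "\<And>A. A \<subseteq> {1..} \<Longrightarrow> infinite A \<Longrightarrow> upper_density (L_set a A) > 0"
  shows "stat_char_subgroup (d_seq a) = char_subgroup (d_seq a)
    \<and> char_subgroup (d_seq a) = circle_of ` group_closure {1 / real (a n) | n. 1 \<le> n}"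
proof -
  let ?G = "circle_of ` group_closure {1 / real (a n) | n. 1 \<le> n}"
  have "?G \<subseteq> char_subgroup (d_seq a)"
  proof (rule image_subsetI)
    fix x assume "x \<in> group_closure {1 / real (a n) | n. 1 \<le> n}"
    then obtain N where N: "1 \<le> N" "real (a N) * x \<in> \<int>"
      using group_closure_inverse_a[OF assms(1-3)] by blast
    have "dist (nat_mult (d_seq a n) (circle_of x)) 0 = 0" if "n \<ge> d_index a N" for n
      using d_seq_mult_eventually_Ints[OF assms(1-3) N that]
      by (simp add: dist_nat_mult_circle_of int_norm_eq_0_iff)
    then have "eventually (\<lambda>n. nat_mult (d_seq a n) (circle_of x) = 0) sequentially"
      by (auto simp: eventually_sequentially)
    then show "circle_of x \<in> char_subgroup (d_seq a)"
      by (simp add: char_subgroup_def tendsto_eventually)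
  qed
  moreover have "char_subgroup (d_seq a) \<subseteq> stat_char_subgroup (d_seq a)"
    by (rule char_subgroup_subset_stat_char_subgroup)
  moreover have "stat_char_subgroup (d_seq a) \<subseteq> ?G"
  proof
    fix t assume t: "t \<in> stat_char_subgroup (d_seq a)"
    obtain x where x: "t = circle_of x"
      using Quotient_abs_rep[OF Quotient_circle, of t] by metis
    then show "t \<in> ?G"
      using ex_mult_Ints_of_stat_char[OF assms(1-4)] t group_closure_inverse_a[OF assms(1-3)] by blast
  qed
  ultimately show ?thesis
    by blast
qed

end
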